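(* Let $A\in\mathbb{R}^{m\times n}$ be nonzero and $b\in\mathbb{R}^m$. Let $\mathcal{D}$ be a distribution of random matrix quadruples $(S_1,S_2,T_1,T_2)$ satisfying $\mathbb{E}[T_1T_2^\top A^\top S_1S_2^\top]=\frac{A^\top}{\|A\|_F^2}$. Let $x_{LS}^*=A^\dagger b$, let $x^1=x^0\in\mathbb{R}^n$ be arbitrary (deterministic) initial vectors, and let $\{x^k\}$ be generated by the mPFR iteration $$x^{k+1}=x^{k}-\alpha T_1T_2^\top A^\top S_1S_2^\top(Ax^{k}-b)+\omega(x^k-x^{k-1}),\qquad k\ge 1,$$ where at each iteration a fresh quadruple $(S_1,S_2,T_1,T_2)$ is drawn independently from $\mathcal{D}$. Denote $r^*=Ax_{LS}^*-b$, $r^k=Ax^k-b$, and $$\beta=\big\|\mathbb{E}[ S_2S_1^\top AT_2T_1^\top A^\top A T_1T_2^\top A^\top S_1S_2^\top ]\big\|_2.$$ Assume $0<\alpha<\frac{\sigma^2_{\min}(A)}{\beta\|A\|^2_F}$, $\omega\geq0$, and that the expressions $$\gamma_1=1+3\omega+2\omega^2-(2\alpha+\alpha\omega)\frac{\sigma^2_{\min}(A)}{\|A\|^2_F}+2\alpha^2\beta\quad\text{and}\quad\gamma_2=2\omega^2+\omega+\omega\alpha\frac{\sigma^2_{\max}(A)}{\|A\|^2_F}$$ satisfy $\gamma_1+\gamma_2<1$. Then $$\mathbb{E}[\|r^{k+1}-r^*\|^2_2]\leq q^k(1+\tau)\|r^0-r^*\|^2_2+\frac{2\alpha^2\beta(1-q^k)\|r^*\|^2_2}{1-q}\qquad\text{for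 all } k\geq 0,$$ where $q=\frac{\gamma_1+\sqrt{\gamma_1^2+4\gamma_2}}{2}$ if $\omega>0$, $q=\gamma_1$ if $\omega=0$, and $\tau=q-\gamma_1\geq 0$. Moreover, $\gamma_1+\gamma_2\leq q<1$.
   Context: $A^\dagger$ is the Moore-Penrose pseudoinverse; $\|\cdot\|_F$ is the Frobenius norm; $\|\cdot\|_2$ is the Euclidean norm of a vector or the spectral norm of a matrix; $\sigma_{\max}(A)$ is the largest singular value and $\sigma_{\min}(A)$ the smallest nonzero singular value of $A$. The linear system $Ax=b$ may be consistent or inconsistent and $A$ may have any rank. The random matrices have sizes $S_1,S_2\in\mathbb{R}^{m\times p}$ and $T_1,T_2\in\mathbb{R}^{n\times s}$, where $p,s$ may themselves be random; the four matrices in a quadruple need not be independent of each other, but quadruples used at different iterations are independent and identically distributed. All expectations appearing are assumed to exist and be finite. *)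

theory Defs
  imports "HOL-Probability.Probability"
begin

(* The type-class norm on real ^ 'n ^ 'm is the Frobenius norm, see frobenius_norm_eq. *)
abbreviation frobenius_norm :: "real ^ 'n ^ 'm \<Rightarrow> real" where
  "frobenius_norm A \<equiv> norm A"

lemma frobenius_norm_eq:
  fixes A :: "real ^ 'n ^ 'm"
  shows "frobenius_norm A = sqrt (\<Sum>i\<in>UNIV. \<Sum>j\<in>UNIV. (A $ i $ j)\<^sup>2)"
  by (simp add: norm_vec_def L2_set_def sum_nonneg)

abbreviation spectral_norm :: "real ^ 'n ^ 'm \<Rightarrow> real" where
  "spectral_norm A \<equiv> onorm ((*v) A)"

(* Square roots of the eigenvalues of A\<^sup>T A. If the matrix has more columns than rows, this set
   contains 0 even when the usual list of min(m, n) singular values does not; neither the largest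
   nor the smallest nonzero singular value of a nonzero matrix is affected. *)
definition singular_values :: "real ^ 'n ^ 'm \<Rightarrow> real set" where
  "singular_values A =
     {\<sigma>. \<sigma> \<ge> 0 \<and> (\<exists>v. v \<noteq> 0 \<and> (transpose A ** A) *v v = \<sigma>\<^sup>2 *\<^sub>R v)}"

definition sigma_max :: "real ^ 'n ^ 'm \<Rightarrow> real" where
  "sigma_max A = Max (singular_values A)"

definition sigma_min :: "real ^ 'n ^ 'm \<Rightarrow> real" where
  "sigma_min A = Min (singular_values A - {0})"

definition is_pseudoinverse :: "real ^ 'n ^ 'm \<Rightarrow> real ^ 'm ^ 'n \<Rightarrow> bool" where
  "is_pseudoinverse A X \<longleftrightarrow>
     A ** X ** A = A \<and> X ** A ** X = X \<and>
     transpose (A ** X) = A ** X \<and> transpose (X ** A) = X ** A"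

definition pseudoinverse :: "real ^ 'n ^ 'm \<Rightarrow> real ^ 'm ^ 'n" where
  "pseudoinverse A = (THE X. is_pseudoinverse A X)"

lemma is_pseudoinverse_unique:
  assumes "is_pseudoinverse A X" and "is_pseudoinverse A Y"
  shows "X = Y"
proof -
  have a: "A ** X = A ** Y"
  proof -
    have "A ** X = transpose (A ** Y ** A ** X)"
      using assms by (simp add: is_pseudoinverse_def)
    also have "\<dots> = transpose (A ** X) ** transpose (A ** Y)"
      by (simp add: matrix_transpose_mul matrix_mul_assoc)
    also have "\<dots> = (A ** X ** A) ** Y"
      using assms by (simp add: is_pseudoinverse_def matrix_mul_assoc)
    finally show ?thesis using assms by (simp add: is_pseudoinverse_def)
  qed
  have b: "X ** A = Y ** A"
  proof -
    have "X ** A = transpose (X ** (A ** Y ** A))"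
      using assms by (simp add: is_pseudoinverse_def)
    also have "\<dots> = transpose (Y ** A) ** transpose (X ** A)"
      by (simp add: matrix_transpose_mul matrix_mul_assoc)
    also have "\<dots> = Y ** A ** (X ** A)"
      using assms by (simp add: is_pseudoinverse_def)
    also have "\<dots> = Y ** (A ** X ** A)"
      by (simp add: matrix_mul_assoc)
    finally show ?thesis using assms by (simp add: is_pseudoinverse_def)
  qed
  have "X = X ** (A ** X)" using assms by (simp add: is_pseudoinverse_def matrix_mul_assoc)
  also have "\<dots> = Y ** A ** Y" by (simp add: a b matrix_mul_assoc)
  finally show ?thesis using assms by (simp add: is_pseudoinverse_def)
qed

(* A matrix with m rows and a number of columns that may be random is represented by the list of
   its columns, so that S is a matrix in R^(m x p) with p = length S. *)
type_synonym 'm columns = "(real ^ 'm) list"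

(* The product of U and the transpose of V, for U and V with the same number of columns. *)
definition mult_transpose :: "'m::finite columns \<Rightarrow> 'm columns \<Rightarrow> real ^ 'm ^ 'm" where
  "mult_transpose U V = (\<chi> i j. \<Sum>l<length U. U ! l $ i * V ! l $ j)"

(* The sigma-algebra generated by the number of columns and the entries, i.e. that of the disjoint
   union of the Borel spaces R^(m x p) over all p. *)
definition columns_algebra :: "'m::finite columns measure" where
  "columns_algebra =
     vimage_algebra UNIV (\<lambda>U. (length U, \<lambda>l. if l < length U then U ! l else 0))
       (count_space UNIV \<Otimes>\<^sub>M (\<Pi>\<^sub>M l\<in>UNIV. borel))"

type_synonym ('m, 'n) quadruple = "'m columns \<times> 'm columns \<times> 'n columns \<times> 'n columns"

definition quadruple_algebra :: "('m::finite, 'n::finite) quadruple measure" where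
  "quadruple_algebra =
     restrict_space
       (columns_algebra \<Otimes>\<^sub>M columns_algebra \<Otimes>\<^sub>M columns_algebra \<Otimes>\<^sub>M columns_algebra)
       {(S1, S2, T1, T2). length S1 = length S2 \<and> length T1 = length T2}"

end

(* With r^* = A x_LS - b, the errors e_k = r^k - r^* lie in the range of A and satisfy
   e_(k+1) = e_k - alpha A H_k (e_k + r^* ) + omega (e_k - e_(k-1)), where H_k is the random matrix
   T_1 T_2^T A^T S_1 S_2^T drawn at step k. Since A^T r^* = 0, averaging over H_k, which is
   independent of e_k and e_(k-1), and using ||A^T e|| >= sigma_min ||e|| on the range of A gives
   E||e_(k+1)||^2 <= gamma_1 E||e_k||^2 + gamma_2 E||e_(k-1)||^2 + 2 alpha^2 beta ||r^*||^2.
   As q^2 = gamma_1 q + gamma_2, the quantity E||e_(k+1)||^2 + (q - gamma_1) E||e_k||^2 contracts by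
   the factor q in each step, up to the additive constant. *)
theory Submission
  imports Defs
begin

section \<open>Pseudoinverse and extreme singular values\<close>

text \<open>The upper bound on alpha enters through the sign of gamma_1. Write s = sigma_min^2 /
  ||A||_F^2. Jensen's inequality for the random matrix A H_k gives s^2 <= beta, so alpha beta <= s
  forces alpha s <= 1, and this makes gamma_1 >= 0. That sign is used to iterate the recursion and
  to identify q for omega = 0 with the root formula. The recursion has memory two, and finiteness of
  E||e_k||^2 has to be proved. So the chain is run on pairs (e_(k+1), e_k), and each step is
  averaged as a Lebesgue integral of a nonnegative function, where Tonelli applies without
  integrability; finiteness then propagates by induction from the deterministic start. The constants
  in gamma_1 and gamma_2 come from 2 <x, y> <= ||x||^2 + ||y||^2 applied to the mixed products. In
  particular ||e + r||^2 <= 2 ||e||^2 + 2 ||r||^2 puts the factor 2 before alpha^2 beta.\<close>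

text \<open>A maximiser of the Rayleigh quotient on the compact unit sphere of \<open>W\<close> is a
  critical point, hence an eigenvector. Invariant subspaces are allowed because the smallest nonzero
  singular value comes from \<open>- (transpose A ** A)\<close> on the range of
  \<open>transpose A\<close>, away from the kernel.\<close>

lemma selfadjoint_max_eigenvector:
  fixes f :: "'a::euclidean_space \<Rightarrow> 'a"
  assumes f: "linear f" and sym: "\<And>u v. f u \<bullet> v = u \<bullet> f v"
    and W: "subspace W" "f ` W \<subseteq> W" "W \<noteq> {0}"
  obtains v l where "v \<in> W" "norm v = 1" "f v = l *\<^sub>R v" "\<And>u. u \<in> W \<Longrightarrow> u \<bullet> f u \<le> l * (norm u)\<^sup>2"
proof -
  let ?S = "sphere 0 1 \<inter> W"
  obtain w where w: "w \<in> W" "w \<noteq> 0"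
    using W subspace_0 by blast
  then have "w /\<^sub>R norm w \<in> ?S"
    using W(1) by (simp add: subspace_scale)
  moreover have "compact ?S"
    using W(1) by (simp add: closed_subspace compact_Int_closed)
  moreover have "continuous_on ?S (\<lambda>v. v \<bullet> f v)"
    using f by (intro continuous_intros linear_continuous_on) (simp add: linear_conv_bounded_linear)
  ultimately obtain v where v: "v \<in> ?S" and max: "\<And>u. u \<in> ?S \<Longrightarrow> u \<bullet> f u \<le> v \<bullet> f v"
    using continuous_attains_sup[of ?S "\<lambda>v. v \<bullet> f v"] by blast
  define l where "l = v \<bullet> f v"
  have bound: "u \<bullet> f u \<le> l * (norm u)\<^sup>2" if "u \<in> W" for u
  proof (cases "u = 0")
    case False
    have "(u /\<^sub>R norm u) \<bullet> f (u /\<^sub>R norm u) \<le> l"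
      using max[of "u /\<^sub>R norm u"] that False W(1) by (simp add: subspace_scale l_def)
    then show ?thesis
      using False by (simp add: linear_scale[OF f] field_simps power2_eq_square)
  qed (simp add: linear_0[OF f])
  \<comment> \<open>Half the gradient at \<open>v\<close> of the defect
    \<open>l * (norm u)\<^sup>2 - u \<bullet> f u\<close>; invariance keeps it in
    \<open>W\<close>.\<close>
  define z where "z = l *\<^sub>R v - f v"
  have vW: "v \<in> W" and v1: "norm v = 1" and vv: "v \<bullet> v = 1"
    using v by (auto simp: norm_eq_1)
  have zW: "z \<in> W"
    using W vW unfolding z_def by (intro subspace_diff subspace_scale) auto
  define C where "C = l * (norm z)\<^sup>2 - z \<bullet> f z"
  have C: "C \<ge> 0"
    using bound[OF zW] by (simp add: C_def)
  \<comment> \<open>The defect \<open>l * (norm u)\<^sup>2 - u \<bullet> f u\<close> is minimal at \<open>v\<close>; comparing with \<open>v - t *\<^sub>R z\<close> for small \<open>t\<close> forces \<open>z = 0\<close>.\<close>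
  have "2 * t * (norm z)\<^sup>2 \<le> t\<^sup>2 * C" for t
  proof -
    have "v - t *\<^sub>R z \<in> W"
      using W vW zW by (intro subspace_diff subspace_scale) auto
    from bound[OF this] have "(v - t *\<^sub>R z) \<bullet> f (v - t *\<^sub>R z) \<le> l * (norm (v - t *\<^sub>R z))\<^sup>2" .
    moreover have "(norm (v - t *\<^sub>R z))\<^sup>2 = 1 - 2 * t * (v \<bullet> z) + t\<^sup>2 * (norm z)\<^sup>2"
      unfolding power2_norm_eq_inner
      by (simp add: inner_diff_left inner_diff_right inner_commute vv power2_eq_square)
    moreover have "(v - t *\<^sub>R z) \<bullet> f (v - t *\<^sub>R z) = l - 2 * t * (z \<bullet> f v) + t\<^sup>2 * (z \<bullet> f z)"
      using sym[of v z]
      by (simp add: linear_diff[OF f] linear_scale[OF f] inner_diff_left inner_diff_right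
          inner_commute l_def power2_eq_square)
    ultimately have "0 \<le> l * (1 - 2 * t * (v \<bullet> z) + t\<^sup>2 * (norm z)\<^sup>2) - (l - 2 * t * (z \<bullet> f v) + t\<^sup>2 * (z \<bullet> f z))"
      by simp
    moreover have "l * (v \<bullet> z) - z \<bullet> f v = (norm z)\<^sup>2"
      unfolding power2_norm_eq_inner z_def
      by (simp add: inner_diff_left inner_diff_right inner_commute vv flip: l_def)
    then have "2 * t * (l * (v \<bullet> z) - z \<bullet> f v) = 2 * t * (norm z)\<^sup>2"
      by simp
    ultimately show ?thesis
      by (simp add: C_def algebra_simps)
  qed
  \<comment> \<open>For \<open>C = 0\<close> the choice \<open>t = 1\<close> suffices. For
    \<open>C > 0\<close> the second choice minimises
    \<open>t\<^sup>2 * C - 2 * t * (norm z)\<^sup>2\<close>.\<close>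
  from this[of 1] this[of "(norm z)\<^sup>2 / C"] have "(norm z)\<^sup>2 \<le> 0"
    using C by (cases "C = 0") (auto simp: power2_eq_square field_simps mult_le_0_iff)
  then have "f v = l *\<^sub>R v"
    by (simp add: z_def)
  with vW v1 bound that show thesis
    by blast
qed

lemma matrix_vector_inner_transpose:
  fixes A :: "real ^ 'n ^ 'm"
  shows "(A *v u) \<bullet> v = u \<bullet> (transpose A *v v)"
  using dot_lmul_matrix[of v A u] by (simp add: inner_commute)

lemma gram_inner:
  fixes A :: "real ^ 'n ^ 'm"
  shows "u \<bullet> ((transpose A ** A) *v v) = (A *v u) \<bullet> (A *v v)"
  by (simp add: matrix_vector_inner_transpose matrix_vector_mul_assoc del: transpose_matrix_vector)

lemma gram_null_iff:
  fixes A :: "real ^ 'n ^ 'm"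
  shows "transpose A *v (A *v v) = 0 \<longleftrightarrow> A *v v = 0"
proof
  assume "transpose A *v (A *v v) = 0"
  then have "(A *v v) \<bullet> (A *v v) = 0"
    by (simp add: matrix_vector_inner_transpose del: transpose_matrix_vector)
  then show "A *v v = 0"
    by simp
qed simp

section \<open>Least squares and existence of the pseudoinverse\<close>

text \<open>Project \<open>y\<close> orthogonally onto the range of \<open>A\<close>; the remainder
  is orthogonal to that range and so is killed by \<open>transpose A\<close>.\<close>

lemma normal_equations_solvable:
  fixes A :: "real ^ 'n ^ 'm"
  shows "\<exists>x. transpose A *v (A *v x) = transpose A *v y"
proof -
  have sub: "span (range ((*v) A)) = range ((*v) A)"
    by (simp add: subspace_UNIV linear_subspace_image span_eq_iff)
  obtain u z where "u \<in> span (range ((*v) A))"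
    and z: "\<And>w. w \<in> span (range ((*v) A)) \<Longrightarrow> orthogonal z w" and y: "y = u + z"
    using orthogonal_subspace_decomp_exists[of "range ((*v) A)" y] by metis
  then obtain x where x: "u = A *v x"
    by (auto simp: sub)
  have "(transpose A *v z) \<bullet> (transpose A *v z) = (A *v (transpose A *v z)) \<bullet> z"
    by (simp add: matrix_vector_inner_transpose del: transpose_matrix_vector)
  also have "\<dots> = 0"
    using z[of "A *v (transpose A *v z)"] by (auto simp: sub orthogonal_def inner_commute)
  finally have "transpose A *v z = 0"
    by simp
  then show ?thesis
    unfolding y x matrix_vector_right_distrib by (intro exI[of _ x]) simp
qed

lemma normal_equations_solvable_matrix:
  fixes A :: "real ^ 'n ^ 'm"
  obtains X where "transpose A ** A ** X = transpose A"
proof -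
  obtain x where x: "\<And>y. transpose A *v (A *v x y) = transpose A *v y"
    using normal_equations_solvable[of A] by metis
  define X where "X = transpose (\<chi> j. x (axis j 1))"
  have col: "X *v axis j 1 = x (axis j 1)" for j
    by (simp add: matrix_vector_mult_basis X_def column_def transpose_def vec_eq_iff)
  have "(transpose A ** A ** X) *v axis j 1 = transpose A *v axis j 1" for j
    using x[of "axis j 1"] by (simp only: col flip: matrix_vector_mul_assoc)
  then have "column j (transpose A ** A ** X) = column j (transpose A)" for j
    by (simp only: matrix_vector_mult_basis)
  then have "transpose A ** A ** X = transpose A"
    by (simp add: column_def vec_eq_iff)
  then show thesis
    by (rule that)
qed

text \<open>Transposing the equation gives
  \<open>transpose (A ** X) = transpose X ** transpose A ** A ** X\<close>, a Gram matrix. For the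
  other claim, \<open>A *v (X *v (A *v v) - v)\<close> lies in the range of \<open>A\<close> and in
  the kernel of \<open>transpose A\<close>. Thus \<open>A ** X\<close> is the orthogonal projection
  onto the range of \<open>A\<close>.\<close>

lemma normal_equations_inverse:
  fixes A :: "real ^ 'n ^ 'm"
  assumes X: "transpose A ** A ** X = transpose A"
  shows "transpose (A ** X) = A ** X" and "A ** X ** A = A"
proof -
  have "transpose (A ** X) = transpose X ** (transpose A ** A ** X)"
    by (simp add: X matrix_transpose_mul)
  also have "\<dots> = transpose (transpose A ** A ** X) ** X"
    by (simp add: matrix_transpose_mul matrix_mul_assoc)
  finally show "transpose (A ** X) = A ** X"
    by (simp add: X)
  have "A *v (X *v (A *v v)) = A *v v" for v
  proof -
    have "transpose A *v (A *v (X *v (A *v v) - v)) = (transpose A ** A ** X ** A - transpose A ** A) *v v"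
      by (simp add: algebra_simps matrix_vector_mul_assoc matrix_mul_assoc del: transpose_matrix_vector)
    also have "\<dots> = 0"
      by (simp add: X)
    finally have "A *v (X *v (A *v v) - v) = 0"
      by (simp only: gram_null_iff)
    then show ?thesis
      by (simp add: matrix_vector_mult_diff_distrib)
  qed
  then show "A ** X ** A = A"
    by (simp add: matrix_eq flip: matrix_vector_mul_assoc)
qed

text \<open>The description by \<open>THE\<close> calls for an existence proof. Two one-sided
  solutions are glued: \<open>X\<close> makes \<open>A ** X\<close> symmetric, and \<open>Y\<close>,
  obtained from the transposed problem, makes \<open>Y ** A\<close> symmetric. Then
  \<open>Y ** A ** X\<close> has both properties.\<close>

lemma is_pseudoinverse_pseudoinverse: "is_pseudoinverse A (pseudoinverse A)"
proof -
  obtain X where "transpose A ** A ** X = transpose A"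
    using normal_equations_solvable_matrix by blast
  note X = normal_equations_inverse[OF this]
  obtain Z where "transpose (transpose A) ** transpose A ** Z = transpose (transpose A)"
    using normal_equations_solvable_matrix by blast
  note Z = normal_equations_inverse[OF this]
  define Y where "Y = transpose Z"
  have Y: "transpose (Y ** A) = Y ** A" "A ** Y ** A = A"
    using arg_cong[OF Z(1), of transpose] arg_cong[OF Z(2), of transpose]
    by (simp_all add: Y_def matrix_transpose_mul matrix_mul_assoc)
  have "A ** (Y ** A ** X) = A ** Y ** A ** X" "Y ** A ** X ** A = Y ** (A ** X ** A)"
    by (simp_all add: matrix_mul_assoc)
  then have AP: "A ** (Y ** A ** X) = A ** X" "Y ** A ** X ** A = Y ** A"
    by (simp_all add: X Y)
  have "Y ** A ** (Y ** A ** X) = Y ** (A ** Y ** A) ** X"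
    by (simp add: matrix_mul_assoc)
  then have "is_pseudoinverse A (Y ** A ** X)"
    by (simp add: is_pseudoinverse_def AP X Y)
  then show ?thesis
    unfolding pseudoinverse_def
    by (rule theI) (erule is_pseudoinverse_unique, fact)
qed

text \<open>Since \<open>A ** pseudoinverse A\<close> is symmetric and fixes \<open>A\<close> from
  the left, transposing yields
  \<open>transpose A ** A ** pseudoinverse A = transpose A\<close>.\<close>

lemma transpose_least_squares_residual:
  "transpose A *v (A *v (pseudoinverse A *v b) - b) = 0"
proof -
  let ?X = "pseudoinverse A"
  have p: "A ** ?X ** A = A" "transpose (A ** ?X) = A ** ?X"
    using is_pseudoinverse_pseudoinverse[of A] by (simp_all add: is_pseudoinverse_def)
  have "transpose A ** (A ** ?X) = transpose (A ** ?X ** A)"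
    by (simp add: matrix_transpose_mul[of "A ** ?X"] p(2))
  then have "transpose A ** (A ** ?X) = transpose A"
    by (simp only: p)
  then show ?thesis
    by (simp add: matrix_vector_mult_diff_distrib matrix_vector_mul_assoc del: transpose_matrix_vector)
qed

section \<open>Norm bounds from the extreme singular values\<close>

text \<open>Eigenvectors of the symmetric Gram matrix for distinct eigenvalues are orthogonal, hence
  independent. Finiteness gives \<open>Max\<close> and \<open>Min\<close> in the definitions of
  \<open>sigma_max\<close> and \<open>sigma_min\<close> their meaning.\<close>

lemma finite_singular_values: "finite (singular_values A)"
proof -
  let ?B = "transpose A ** A"
  have "\<forall>s\<in>singular_values A. \<exists>v. v \<noteq> 0 \<and> ?B *v v = s\<^sup>2 *\<^sub>R v"
    by (simp add: singular_values_def)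
  then obtain v where v: "\<And>s. s \<in> singular_values A \<Longrightarrow> v s \<noteq> 0 \<and> ?B *v v s = s\<^sup>2 *\<^sub>R v s"
    using bchoice by metis
  have orth: "v s \<bullet> v t = 0" if "s \<in> singular_values A" "t \<in> singular_values A" "s \<noteq> t" for s t
  proof -
    have "s\<^sup>2 * (v s \<bullet> v t) = (?B *v v s) \<bullet> v t" "t\<^sup>2 * (v s \<bullet> v t) = v s \<bullet> (?B *v v t)"
      using v that by simp_all
    then have "s\<^sup>2 * (v s \<bullet> v t) = t\<^sup>2 * (v s \<bullet> v t)"
      by (simp add: matrix_vector_inner_transpose matrix_transpose_mul)
    \<comment> \<open>Squaring is injective here because singular values are nonnegative.\<close>
    moreover have "s\<^sup>2 \<noteq> t\<^sup>2"
      using that by (simp add: singular_values_def)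
    ultimately show ?thesis
      by simp
  qed
  have "pairwise orthogonal (v ` singular_values A)"
    unfolding pairwise_def orthogonal_def using orth by blast
  then have "independent (v ` singular_values A)"
    using v by (intro pairwise_orthogonal_independent) auto
  then have "finite (v ` singular_values A)"
    by (rule independent_imp_finite)
  moreover have "inj_on v (singular_values A)"
    using orth v by (metis inj_onI inner_eq_zero_iff)
  ultimately show ?thesis
    by (rule finite_imageD)
qed

text \<open>The largest Rayleigh quotient \<open>l\<close> of the Gram matrix is an eigenvalue, so
  \<open>sqrt l\<close> is one of the singular values.\<close>

lemma norm_le_sigma_max:
  fixes A :: "real ^ 'n ^ 'm"
  shows "(norm (A *v v))\<^sup>2 \<le> (sigma_max A)\<^sup>2 * (norm v)\<^sup>2"
proof -
  have sym: "((transpose A ** A) *v u) \<bullet> v = u \<bullet> ((transpose A ** A) *v v)" for u v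
    by (simp add: matrix_vector_inner_transpose matrix_transpose_mul)
  have "(UNIV :: (real ^ 'n) set) \<noteq> {0}"
    using axis_eq_0_iff[of undefined "1::real"] by (metis UNIV_I singletonD zero_neq_one)
  then obtain w l where w: "norm w = 1" "(transpose A ** A) *v w = l *\<^sub>R w"
    and le: "\<And>u. u \<bullet> ((transpose A ** A) *v u) \<le> l * (norm u)\<^sup>2"
    using selfadjoint_max_eigenvector[of "(*v) (transpose A ** A)" UNIV] sym by auto
  have "l = w \<bullet> ((transpose A ** A) *v w)"
    using w by (simp add: norm_eq_1)
  then have l: "l \<ge> 0"
    by (simp add: gram_inner)
  have "sqrt l \<in> singular_values A"
    using l w unfolding singular_values_def by (auto intro!: exI[of _ w])
  then have "sqrt l \<le> sigma_max A"
    unfolding sigma_max_def by (intro Max_ge finite_singular_values)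
  then have "l \<le> (sigma_max A)\<^sup>2"
    using l power_mono[of "sqrt l" "sigma_max A" 2] by simp
  then show ?thesis
    using order_trans[OF le[of v] mult_right_mono[of l "(sigma_max A)\<^sup>2" "(norm v)\<^sup>2"]]
    by (simp add: gram_inner power2_norm_eq_inner)
qed

text \<open>Duality: for \<open>w = transpose A *v u\<close>, the square of \<open>norm w\<close>
  equals \<open>(A *v w) \<bullet> u\<close>, and one factor \<open>norm w\<close> cancels.\<close>

lemma norm_transpose_le_sigma_max:
  fixes A :: "real ^ 'n ^ 'm"
  shows "(norm (transpose A *v u))\<^sup>2 \<le> (sigma_max A)\<^sup>2 * (norm u)\<^sup>2"
proof -
  define w where "w = transpose A *v u"
  \<comment> \<open>The absolute value makes a bound on norms possible without knowing the sign of
    \<open>sigma_max A\<close>.\<close>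
  define s where "s = \<bar>sigma_max A\<bar>"
  have le: "norm (A *v w) \<le> s * norm w"
    using norm_le_sigma_max[of A w] unfolding s_def
    by - (rule power2_le_imp_le, simp_all add: power_mult_distrib)
  have "(norm w)\<^sup>2 = (A *v w) \<bullet> u"
    unfolding power2_norm_eq_inner matrix_vector_inner_transpose by (simp only: w_def)
  also have "\<dots> \<le> norm (A *v w) * norm u"
    by (rule norm_cauchy_schwarz)
  also have "\<dots> \<le> s * norm w * norm u"
    by (rule mult_right_mono[OF le]) simp
  finally have "norm w * norm w \<le> norm w * (s * norm u)"
    by (simp only: power2_eq_square mult_ac)
  then have "norm w \<le> s * norm u"
    by (cases "w = 0") (simp_all add: s_def)
  then have "(norm w)\<^sup>2 \<le> (s * norm u)\<^sup>2"
    by (intro power_mono) simp_all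
  then show ?thesis
    by (simp only: power_mult_distrib s_def w_def power2_abs)
qed

text \<open>Minimise the Rayleigh quotient of the Gram matrix over the range of
  \<open>transpose A\<close>. That range meets the kernel of \<open>A\<close> only in 0, so the
  minimum \<open>m\<close> is positive and \<open>sqrt m\<close> is a nonzero singular value; it
  also shows that the set under \<open>Min\<close> is nonempty.\<close>

lemma sigma_min:
  fixes A :: "real ^ 'n ^ 'm"
  assumes "A \<noteq> 0"
  shows sigma_min_pos: "sigma_min A > 0"
    and sigma_min_le_norm: "(sigma_min A)\<^sup>2 * (norm (transpose A *v v))\<^sup>2 \<le> (norm (A *v (transpose A *v v)))\<^sup>2"
proof -
  let ?B = "transpose A ** A" and ?W = "range ((*v) (transpose A))"
  have lin: "linear (\<lambda>v. - (?B *v v))"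
    by (intro linear_compose_neg matrix_vector_mul_linear)
  have sym: "(- (?B *v u)) \<bullet> v = u \<bullet> (- (?B *v v))" for u v
    by (simp add: matrix_vector_inner_transpose matrix_transpose_mul)
  have W: "subspace ?W"
    by (intro linear_subspace_image) auto
  have "- (?B *v u) = transpose A *v (- (A *v u))" for u
    by (simp add: matrix_vector_mul_assoc linear_neg[OF matrix_vector_mul_linear] del: transpose_matrix_vector)
  then have BW: "(\<lambda>v. - (?B *v v)) ` ?W \<subseteq> ?W"
    by auto
  have "transpose A \<noteq> 0"
    using assms by (auto simp: transpose_def vec_eq_iff)
  then have "?W \<noteq> {0}"
    by (auto simp: matrix_eq simp del: transpose_matrix_vector)
  then obtain w l where w: "w \<in> ?W" "norm w = 1" "- (?B *v w) = l *\<^sub>R w"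
    and le: "\<And>u. u \<in> ?W \<Longrightarrow> u \<bullet> (- (?B *v u)) \<le> l * (norm u)\<^sup>2"
    using selfadjoint_max_eigenvector[OF lin sym W BW] by metis
  define m where "m = - l"
  have Bw: "?B *v w = m *\<^sub>R w"
    using w(3) by (simp add: m_def) (metis minus_equation_iff)
  have ge: "m * (norm u)\<^sup>2 \<le> (norm (A *v u))\<^sup>2" if "u \<in> ?W" for u
    using le[OF that] by (simp add: m_def gram_inner power2_norm_eq_inner)
  have "A *v w \<noteq> 0"
  proof
    assume Aw: "A *v w = 0"
    obtain u where "w = transpose A *v u"
      using w by auto
    then have "w \<bullet> w = 0"
      using Aw matrix_vector_inner_transpose[of A w u] by simp
    then show False
      using w by auto
  qed
  moreover have "m = (A *v w) \<bullet> (A *v w)"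
    using gram_inner[of w A w] w by (simp add: Bw norm_eq_1)
  ultimately have m: "m > 0"
    by simp
  have fin: "finite (singular_values A - {0})"
    by (simp add: finite_singular_values)
  have "w \<noteq> 0"
    using w by auto
  then have mem: "sqrt m \<in> singular_values A - {0}"
    using m Bw unfolding singular_values_def by (auto intro!: exI[of _ w])
  then have "sigma_min A \<in> singular_values A - {0}"
    unfolding sigma_min_def using fin by (intro Min_in) auto
  then show pos: "sigma_min A > 0"
    by (auto simp: singular_values_def)
  have "sigma_min A \<le> sqrt m"
    unfolding sigma_min_def using fin mem by (intro Min_le)
  then have "(sigma_min A)\<^sup>2 \<le> (sqrt m)\<^sup>2"
    using pos by (intro power_mono) simp_all
  then have "(sigma_min A)\<^sup>2 * (norm (transpose A *v v))\<^sup>2 \<le> m * (norm (transpose A *v v))\<^sup>2"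
    using m by (intro mult_right_mono) simp_all
  also have "\<dots> \<le> (norm (A *v (transpose A *v v)))\<^sup>2"
    by (intro ge) simp
  finally show "(sigma_min A)\<^sup>2 * (norm (transpose A *v v))\<^sup>2 \<le> (norm (A *v (transpose A *v v)))\<^sup>2" .
qed


text \<open>Carries the lower bound over from the row space of \<open>A\<close> to its column space.
  Write \<open>A *v u = A *v z\<close> with \<open>z\<close> in the row space, and combine
  Cauchy-Schwarz for \<open>z \<bullet> (transpose A *v (A *v u))\<close> with the bound for
  \<open>z\<close>.\<close>

lemma sigma_min_le_norm_transpose:
  fixes A :: "real ^ 'n ^ 'm"
  assumes "A \<noteq> 0"
  shows "(sigma_min A)\<^sup>2 * (norm (A *v u))\<^sup>2 \<le> (norm (transpose A *v (A *v u)))\<^sup>2"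
proof -
  let ?s = "sigma_min A" and ?e = "A *v u"
  \<comment> \<open>The normal equations of \<open>transpose A\<close> supply a preimage of
    \<open>?e\<close> in the row space.\<close>
  obtain v where "A *v (transpose A *v v) = ?e"
    using normal_equations_solvable[of "transpose A" u] unfolding transpose_transpose by blast
  moreover define z where "z = transpose A *v v"
  ultimately have z: "A *v z = ?e" "?s\<^sup>2 * (norm z)\<^sup>2 \<le> (norm ?e)\<^sup>2"
    using sigma_min_le_norm[OF assms, of v] by metis+
  have s: "?s > 0"
    using sigma_min_pos[OF assms] .
  have zn: "?s * norm z \<le> norm ?e"
    using z(2) by - (rule power2_le_imp_le, simp_all add: power_mult_distrib)
  have "(norm ?e)\<^sup>2 = z \<bullet> (transpose A *v ?e)"
    unfolding power2_norm_eq_inner using matrix_vector_inner_transpose[of A z ?e] by (simp only: z)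
  also have "\<dots> \<le> norm z * norm (transpose A *v ?e)"
    by (rule norm_cauchy_schwarz)
  finally have "?s * (norm ?e)\<^sup>2 \<le> (?s * norm z) * norm (transpose A *v ?e)"
    using s by simp
  also have "\<dots> \<le> norm ?e * norm (transpose A *v ?e)"
    by (intro mult_right_mono zn) simp
  finally have "norm ?e * (?s * norm ?e) \<le> norm ?e * norm (transpose A *v ?e)"
    by (simp add: power2_eq_square algebra_simps)
  then have "?s * norm ?e \<le> norm (transpose A *v ?e)"
    by (cases "?e = 0") simp_all
  then have "(?s * norm ?e)\<^sup>2 \<le> (norm (transpose A *v ?e))\<^sup>2"
    using s by (intro power_mono) simp_all
  then show ?thesis
    by (simp add: power_mult_distrib)
qed

section \<open>Markov chains driven by independent innovations\<close>

text \<open>Unrolling the recursion expresses the state at time \<open>k\<close> measurably through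
  the first \<open>k\<close> innovations alone; its independence of the next innovation rests on
  this.\<close>

lemma (in prob_space) markov_chain_adapted:
  fixes Q :: "nat \<Rightarrow> 'a \<Rightarrow> 'q" and Z :: "nat \<Rightarrow> 'a \<Rightarrow> 'z"
  assumes F[measurable]: "(\<lambda>(z, q). F z q) \<in> P \<Otimes>\<^sub>M N \<rightarrow>\<^sub>M P"
    and z0: "z0 \<in> space P" "\<And>w. w \<in> space M \<Longrightarrow> Z 0 w = z0"
    and Z: "\<And>k w. w \<in> space M \<Longrightarrow> Z (Suc k) w = F (Z k w) (Q (Suc k) w)"
  shows "\<exists>h \<in> PiM {1..k} (\<lambda>_. N) \<rightarrow>\<^sub>M P. \<forall>w\<in>space M. Z k w = h (restrict (\<lambda>i. Q i w) {1..k})"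
proof (induction k)
  case 0
  then show ?case
    using z0 by (intro bexI[of _ "\<lambda>_. z0"]) auto
next
  case (Suc k)
  then obtain h where h[measurable]: "h \<in> PiM {1..k} (\<lambda>_. N) \<rightarrow>\<^sub>M P"
    and Zk: "\<And>w. w \<in> space M \<Longrightarrow> Z k w = h (restrict (\<lambda>i. Q i w) {1..k})"
    by blast
  have [measurable]: "(\<lambda>g. restrict g {1..k}) \<in> PiM {1..Suc k} (\<lambda>_. N) \<rightarrow>\<^sub>M PiM {1..k} (\<lambda>_. N)"
    by (rule measurable_restrict_subset) auto
  have [measurable]: "(\<lambda>g. g (Suc k)) \<in> PiM {1..Suc k} (\<lambda>_. N) \<rightarrow>\<^sub>M N"
    by (rule measurable_component_singleton) simp
  have "(\<lambda>g. F (h (restrict g {1..k})) (g (Suc k))) \<in> PiM {1..Suc k} (\<lambda>_. N) \<rightarrow>\<^sub>M P"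
    by measurable
  moreover have "{1..Suc k} \<inter> {1..k} = {1..k}"
    by auto
  ultimately show ?case
    by (intro bexI[of _ "\<lambda>g. F (h (restrict g {1..k})) (g (Suc k))"])
      (simp_all add: Z Zk restrict_restrict cong: restrict_cong)
qed

lemma (in prob_space) markov_chain_measurable:
  fixes Q :: "nat \<Rightarrow> 'a \<Rightarrow> 'q" and Z :: "nat \<Rightarrow> 'a \<Rightarrow> 'z"
  assumes "indep_vars (\<lambda>_. N) Q {1..}"
    and "(\<lambda>(z, q). F z q) \<in> P \<Otimes>\<^sub>M N \<rightarrow>\<^sub>M P"
    and "z0 \<in> space P" "\<And>w. w \<in> space M \<Longrightarrow> Z 0 w = z0"
    and "\<And>k w. w \<in> space M \<Longrightarrow> Z (Suc k) w = F (Z k w) (Q (Suc k) w)"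
  shows "Z k \<in> M \<rightarrow>\<^sub>M P"
proof -
  obtain h where h[measurable]: "h \<in> PiM {1..k} (\<lambda>_. N) \<rightarrow>\<^sub>M P"
    and Zk: "\<And>w. w \<in> space M \<Longrightarrow> Z k w = h (restrict (\<lambda>i. Q i w) {1..k})"
    using markov_chain_adapted[where Q = Q and k = k, OF assms(2-5)] by blast
  have [measurable]: "Q i \<in> M \<rightarrow>\<^sub>M N" if "i \<in> {1..k}" for i
    using assms(1) that by (auto simp: indep_vars_def)
  have R: "(\<lambda>w. restrict (\<lambda>i. Q i w) {1..k}) \<in> M \<rightarrow>\<^sub>M PiM {1..k} (\<lambda>_. N)"
    by (intro measurable_restrict) simp
  have "(\<lambda>w. h (restrict (\<lambda>i. Q i w) {1..k})) \<in> M \<rightarrow>\<^sub>M P"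
    by (rule measurable_compose[OF R h])
  then show ?thesis
    using measurable_cong[of M "Z k", OF Zk] by blast
qed

text \<open>The next innovation is independent of the current state, so the joint law is a product
  and Tonelli allows averaging over the innovation with the state frozen. Nonnegative integrals make
  this available before any moment is known to be finite.\<close>

lemma (in prob_space) markov_chain_nn_integral:
  fixes Q :: "nat \<Rightarrow> 'a \<Rightarrow> 'q" and Z :: "nat \<Rightarrow> 'a \<Rightarrow> 'z"
  assumes ind: "indep_vars (\<lambda>_. N) Q {1..}" and dist: "distr M N (Q (Suc k)) = D"
    and F[measurable]: "(\<lambda>(z, q). F z q) \<in> P \<Otimes>\<^sub>M N \<rightarrow>\<^sub>M P"
    and z0: "z0 \<in> space P" "\<And>w. w \<in> space M \<Longrightarrow> Z 0 w = z0"
    and Z: "\<And>k w. w \<in> space M \<Longrightarrow> Z (Suc k) w = F (Z k w) (Q (Suc k) w)"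
    and f[measurable]: "f \<in> borel_measurable P"
  shows "(\<integral>\<^sup>+w. f (Z (Suc k) w) \<partial>M) = (\<integral>\<^sup>+w. (\<integral>\<^sup>+q. f (F (Z k w) q) \<partial>D) \<partial>M)"
proof -
  define I where "I = {1..k}"
  obtain h where h[measurable]: "h \<in> PiM I (\<lambda>_. N) \<rightarrow>\<^sub>M P"
    and Zk: "\<And>w. w \<in> space M \<Longrightarrow> Z k w = h (restrict (\<lambda>i. Q i w) I)"
    unfolding I_def using markov_chain_adapted[where Q = Q and k = k, OF F z0 Z] by blast
  have Zm[measurable]: "Z k \<in> M \<rightarrow>\<^sub>M P"
    by (rule markov_chain_measurable[OF ind F z0 Z])
  have Qm[measurable]: "Q (Suc k) \<in> M \<rightarrow>\<^sub>M N"
    using ind by (auto simp: indep_vars_def)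
  \<comment> \<open>Independence of blocks concerns restrictions to index sets, so the next
    innovation appears as the one-element block \<open>{Suc k}\<close>, read off at
    \<open>Suc k\<close>.\<close>
  define R where "R = (\<lambda>J w. restrict (\<lambda>i. Q i w) J)"
  let ?N = "\<lambda>J. PiM J (\<lambda>_. N)"
  have Rm[measurable]: "R J \<in> M \<rightarrow>\<^sub>M ?N J" if "J \<subseteq> {1..}" for J
    unfolding R_def using ind that by (intro measurable_restrict) (auto simp: indep_vars_def)
  have [measurable]: "R I \<in> M \<rightarrow>\<^sub>M ?N I" "R {Suc k} \<in> M \<rightarrow>\<^sub>M ?N {Suc k}"
    by (auto intro!: Rm simp: I_def)
  have [measurable]: "(\<lambda>g. g (Suc k)) \<in> ?N {Suc k} \<rightarrow>\<^sub>M N"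
    by (rule measurable_component_singleton) simp
  have "indep_var (?N I) (R I) (?N {Suc k}) (R {Suc k})"
    unfolding R_def by (rule indep_var_restrict[OF ind]) (auto simp: I_def)
  then have pair: "distr M (?N I \<Otimes>\<^sub>M ?N {Suc k}) (\<lambda>w. (R I w, R {Suc k} w)) =
      distr M (?N I) (R I) \<Otimes>\<^sub>M distr M (?N {Suc k}) (R {Suc k})"
    by (simp add: indep_var_distribution_eq)
  interpret D': prob_space "distr M (?N {Suc k}) (R {Suc k})"
    by (rule prob_space_distr) (simp add: Rm)
  have ZR: "Z k w = h (R I w)" if "w \<in> space M" for w
    using Zk[OF that] by (simp add: R_def)
  have inner: "(\<integral>\<^sup>+y. f (F z (y (Suc k))) \<partial>distr M (?N {Suc k}) (R {Suc k})) = (\<integral>\<^sup>+q. f (F z q) \<partial>D)"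
    if [measurable]: "z \<in> space P" for z
  proof -
    have [measurable]: "(\<lambda>q. f (F z q)) \<in> borel_measurable N"
      using measurable_compose[OF measurable_Pair1'[OF that, of N] measurable_compose[OF F f]]
      by simp
    show ?thesis
      unfolding dist[symmetric]
      by (subst (1 2) nn_integral_distr) (simp_all add: Rm, simp add: R_def)
  qed
  have "(\<integral>\<^sup>+w. f (Z (Suc k) w) \<partial>M) = (\<integral>\<^sup>+w. f (F (h (R I w)) (R {Suc k} w (Suc k))) \<partial>M)"
    by (intro nn_integral_cong) (simp add: Z ZR, simp add: R_def)
  also have "\<dots> = (\<integral>\<^sup>+p. f (F (h (fst p)) (snd p (Suc k)))
      \<partial>(distr M (?N I) (R I) \<Otimes>\<^sub>M distr M (?N {Suc k}) (R {Suc k})))"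
    unfolding pair[symmetric] by (subst nn_integral_distr) simp_all
  also have "\<dots> = (\<integral>\<^sup>+x. (\<integral>\<^sup>+y. f (F (h x) (y (Suc k))) \<partial>distr M (?N {Suc k}) (R {Suc k}))
      \<partial>distr M (?N I) (R I))"
    by (subst D'.nn_integral_fst[symmetric]) simp_all
  also have "\<dots> = (\<integral>\<^sup>+w. (\<integral>\<^sup>+y. f (F (h (R I w)) (y (Suc k))) \<partial>distr M (?N {Suc k}) (R {Suc k})) \<partial>M)"
    by (rule nn_integral_distr) (simp_all add: Rm)
  also have "\<dots> = (\<integral>\<^sup>+w. (\<integral>\<^sup>+q. f (F (Z k w) q) \<partial>D) \<partial>M)"
    using measurable_space[OF Zm] by (intro nn_integral_cong) (simp add: inner flip: ZR)
  finally show ?thesis .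
qed

section \<open>The scalar two-step recursion\<close>

lemma two_step_recursion_bound:
  fixes E :: "nat \<Rightarrow> real"
  assumes nonneg: "\<And>k. E k \<ge> 0" and start: "E 1 = E 0"
    and \<gamma>: "\<gamma>1 \<ge> 0" "\<gamma>2 \<ge> 0" "\<gamma>1 + \<gamma>2 < 1"
    and step: "\<And>k. E (Suc (Suc k)) \<le> \<gamma>1 * E (Suc k) + \<gamma>2 * E k + c"
    and q: "q = (\<gamma>1 + sqrt (\<gamma>1\<^sup>2 + 4 * \<gamma>2)) / 2"
  shows "q \<ge> \<gamma>1" "\<gamma>1 + \<gamma>2 \<le> q" "q < 1"
    and "E (Suc k) \<le> q ^ k * (1 + (q - \<gamma>1)) * E 0 + c * (1 - q ^ k) / (1 - q)"
proof -
  define s where "s = sqrt (\<gamma>1\<^sup>2 + 4 * \<gamma>2)"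
  have s2: "s\<^sup>2 = \<gamma>1\<^sup>2 + 4 * \<gamma>2"
    using \<gamma> by (simp add: s_def)
  have "\<gamma>1 \<le> s"
    using \<gamma> unfolding s_def by (intro real_le_rsqrt) simp
  then show q_ge: "q \<ge> \<gamma>1"
    by (simp add: q s_def)
  \<comment> \<open>The difference of the two sides is
    \<open>4 * (1 - \<gamma>1 - \<gamma>2)\<close>.\<close>
  have "\<gamma>1\<^sup>2 + 4 * \<gamma>2 < (2 - \<gamma>1)\<^sup>2"
    using \<gamma> by (simp add: power2_eq_square algebra_simps)
  then have "s < 2 - \<gamma>1"
    unfolding s_def using \<gamma> by (intro real_less_lsqrt) auto
  then show q1: "q < 1"
    by (simp add: q s_def)
  define t where "t = q - \<gamma>1"
  have tq: "t * q = \<gamma>2"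
    using s2 by (simp add: t_def q flip: s_def) (simp add: field_simps power2_eq_square)
  have t: "t \<ge> 0" and q0: "q \<ge> 0"
    using q_ge \<gamma> by (simp_all add: t_def)
  have "t * q \<le> t"
    using t q1 by (simp add: mult_left_le)
  then show "\<gamma>1 + \<gamma>2 \<le> q"
    by (simp add: tq) (simp add: t_def)
  \<comment> \<open>At \<open>k = 0\<close> the equal starting values turn the left side into
    \<open>(1 + t) * E 0\<close>, the origin of the factor \<open>1 + \<tau>\<close> in the
    theorem.\<close>
  have geo: "E (Suc k) + t * E k \<le> q ^ k * (1 + t) * E 0 + c * (1 - q ^ k) / (1 - q)" for k
  proof (induction k)
    case 0
    then show ?case
      using start by (simp add: algebra_simps)
  next
    case (Suc k)
    have "E (Suc (Suc k)) + t * E (Suc k) \<le> q * (E (Suc k) + t * E k) + c"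
      using step[of k] by (simp add: t_def algebra_simps flip: tq)
    also have "\<dots> \<le> q * (q ^ k * (1 + t) * E 0 + c * (1 - q ^ k) / (1 - q)) + c"
      using Suc q0 by (simp add: mult_left_mono)
    also have "\<dots> = q ^ Suc k * (1 + t) * E 0 + c * (1 - q ^ Suc k) / (1 - q)"
      using q1 by (simp add: field_simps)
    finally show ?case .
  qed
  show "E (Suc k) \<le> q ^ k * (1 + (q - \<gamma>1)) * E 0 + c * (1 - q ^ k) / (1 - q)"
    using geo[of k] mult_nonneg_nonneg[OF t nonneg[of k]] unfolding t_def by linarith
qed

section \<open>One step of the iteration in mean square\<close>

lemma bounded_linear_matrix_mult_right:
  fixes A :: "real ^ 'k ^ 'm"
  shows "bounded_linear (\<lambda>B :: real ^ 'n ^ 'k. A ** B)"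
  by (rule linear_conv_bounded_linear[THEN iffD1], rule linearI)
    (simp_all add: vec_eq_iff matrix_matrix_mult_def algebra_simps sum.distrib sum_distrib_left)

lemma bounded_linear_matrix_vector_mult_left:
  "bounded_linear (\<lambda>B :: real ^ 'n ^ 'm. B *v y)"
  by (rule linear_conv_bounded_linear[THEN iffD1], rule linearI)
    (simp_all add: matrix_vector_mult_add_rdistrib scaleR_matrix_vector_assoc)

lemma borel_measurable_matrix_vector_mult:
  fixes f :: "'a \<Rightarrow> real ^ 'n ^ 'm"
  assumes "f \<in> borel_measurable M" "g \<in> borel_measurable M"
  shows "(\<lambda>x. f x *v g x) \<in> borel_measurable M"
  by (rule borel_measurable_continuous_Pair[OF assms])
    (simp add: matrix_vector_mult_def, intro continuous_intros)

text \<open>The squared norm is \<open>y \<bullet> ((transpose (G q) ** G q) *v y)\<close>, linear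
  in the Gram matrix, so integrability and expectation pass through.\<close>

lemma
  fixes G :: "'q \<Rightarrow> real ^ 'm ^ 'm"
  assumes G: "integrable D (\<lambda>q. transpose (G q) ** G q)"
  shows integrable_norm_matrix_vector: "integrable D (\<lambda>q. (norm (G q *v y))\<^sup>2)"
    and integral_norm_matrix_vector_le:
      "(\<integral>q. (norm (G q *v y))\<^sup>2 \<partial>D) \<le> spectral_norm (\<integral>q. transpose (G q) ** G q \<partial>D) * (norm y)\<^sup>2"
proof -
  let ?B = "\<integral>q. transpose (G q) ** G q \<partial>D"
  have bl: "bounded_linear (\<lambda>B :: real ^ 'm ^ 'm. y \<bullet> (B *v y))"
    by (rule bounded_linear_compose[OF bounded_linear_inner_right bounded_linear_matrix_vector_mult_left])
  have eq: "(norm (G q *v y))\<^sup>2 = y \<bullet> ((transpose (G q) ** G q) *v y)" for q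
    by (simp add: gram_inner power2_norm_eq_inner)
  show "integrable D (\<lambda>q. (norm (G q *v y))\<^sup>2)"
    unfolding eq by (rule integrable_bounded_linear[OF bl G])
  have "(\<integral>q. (norm (G q *v y))\<^sup>2 \<partial>D) = y \<bullet> (?B *v y)"
    unfolding eq by (rule integral_bounded_linear[OF bl G])
  also have "\<dots> \<le> norm y * norm (?B *v y)"
    by (rule norm_cauchy_schwarz)
  also have "\<dots> \<le> norm y * (spectral_norm ?B * norm y)"
    by (intro mult_left_mono onorm) simp_all
  finally show "(\<integral>q. (norm (G q *v y))\<^sup>2 \<partial>D) \<le> spectral_norm ?B * (norm y)\<^sup>2"
    by (simp add: power2_eq_square mult_ac)
qed

text \<open>Expanding the square, the cross term is linear in \<open>G q\<close> and sees only its
  mean.\<close>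

lemma (in prob_space)
  fixes G :: "'a \<Rightarrow> real ^ 'm ^ 'm"
  assumes G: "integrable M G" and G2: "integrable M (\<lambda>q. transpose (G q) ** G q)"
  shows integrable_norm_affine: "integrable M (\<lambda>q. (norm (p - a *\<^sub>R (G q *v y)))\<^sup>2)"
    and integral_norm_affine: "(\<integral>q. (norm (p - a *\<^sub>R (G q *v y)))\<^sup>2 \<partial>M) =
      (norm p)\<^sup>2 - 2 * a * (p \<bullet> ((\<integral>q. G q \<partial>M) *v y)) + a\<^sup>2 * (\<integral>q. (norm (G q *v y))\<^sup>2 \<partial>M)"
proof -
  have bl: "bounded_linear (\<lambda>B :: real ^ 'm ^ 'm. p \<bullet> (B *v y))"
    by (rule bounded_linear_compose[OF bounded_linear_inner_right bounded_linear_matrix_vector_mult_left])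
  note int = integrable_bounded_linear[OF bl G] integrable_norm_matrix_vector[OF G2, of y]
  have eq: "(norm (p - a *\<^sub>R (G q *v y)))\<^sup>2 =
      (norm p)\<^sup>2 - 2 * a * (p \<bullet> (G q *v y)) + a\<^sup>2 * (norm (G q *v y))\<^sup>2" for q
    unfolding power2_norm_eq_inner
    by (simp add: inner_diff_left inner_diff_right inner_commute power2_eq_square)
  show "integrable M (\<lambda>q. (norm (p - a *\<^sub>R (G q *v y)))\<^sup>2)"
    unfolding eq using int by simp
  show "(\<integral>q. (norm (p - a *\<^sub>R (G q *v y)))\<^sup>2 \<partial>M) =
      (norm p)\<^sup>2 - 2 * a * (p \<bullet> ((\<integral>q. G q \<partial>M) *v y)) + a\<^sup>2 * (\<integral>q. (norm (G q *v y))\<^sup>2 \<partial>M)"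
    unfolding eq using int integral_bounded_linear[OF bl G] by (simp add: prob_space)
qed

text \<open>Here \<open>u\<close> and \<open>u'\<close> are the current and previous errors,
  \<open>a\<close> and \<open>a'\<close> their images under the transpose of \<open>A\<close>
  divided by its Frobenius norm, and \<open>m\<close> the second moment of the random update. The
  coefficients arise from \<open>(1 + \<omega>)\<^sup>2 + \<omega> * (1 + \<omega>)\<close>,
  \<open>\<omega>\<^sup>2 + \<omega> * (1 + \<omega>)\<close> and
  \<open>- 2 * \<alpha> * (1 + \<omega>) + \<alpha> * \<omega>\<close>.\<close>

lemma momentum_quadratic_bound:
  fixes u u' r :: "'a::real_inner" and a a' :: "'b::real_inner"
  assumes "\<alpha> \<ge> 0" "\<omega> \<ge> 0" "\<beta> \<ge> 0"
    and m: "m \<le> \<beta> * (norm (u + r))\<^sup>2"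
    and a: "s * (norm u)\<^sup>2 \<le> (norm a)\<^sup>2" and a': "(norm a')\<^sup>2 \<le> S * (norm u')\<^sup>2"
  shows "(norm ((1 + \<omega>) *\<^sub>R u - \<omega> *\<^sub>R u'))\<^sup>2 - 2 * \<alpha> * ((1 + \<omega>) * (a \<bullet> a) - \<omega> * (a' \<bullet> a)) + \<alpha>\<^sup>2 * m
    \<le> (1 + 3 * \<omega> + 2 * \<omega>\<^sup>2 - (2 * \<alpha> + \<alpha> * \<omega>) * s + 2 * \<alpha>\<^sup>2 * \<beta>) * (norm u)\<^sup>2
      + (2 * \<omega>\<^sup>2 + \<omega> + \<omega> * \<alpha> * S) * (norm u')\<^sup>2 + 2 * \<alpha>\<^sup>2 * \<beta> * (norm r)\<^sup>2"
proof -
  have young: "2 * (x \<bullet> y) \<le> (norm x)\<^sup>2 + (norm y)\<^sup>2" "- 2 * (x \<bullet> y) \<le> (norm x)\<^sup>2 + (norm y)\<^sup>2"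
    for x y :: "'c::real_inner"
    using inner_ge_zero[of "x - y"] inner_ge_zero[of "x + y"]
    by (simp_all add: power2_norm_eq_inner inner_diff_left inner_diff_right inner_add_left
        inner_add_right inner_commute)
  have "(norm ((1 + \<omega>) *\<^sub>R u - \<omega> *\<^sub>R u'))\<^sup>2 =
      (1 + \<omega>)\<^sup>2 * (norm u)\<^sup>2 + (\<omega> * (1 + \<omega>)) * (- 2 * (u \<bullet> u')) + \<omega>\<^sup>2 * (norm u')\<^sup>2"
    unfolding power2_norm_eq_inner
    by (simp add: inner_diff_left inner_diff_right inner_commute) (simp add: algebra_simps power2_eq_square)
  also have "(\<omega> * (1 + \<omega>)) * (- 2 * (u \<bullet> u')) \<le> (\<omega> * (1 + \<omega>)) * ((norm u)\<^sup>2 + (norm u')\<^sup>2)"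
    using assms by (intro mult_left_mono young) simp
  finally have 1: "(norm ((1 + \<omega>) *\<^sub>R u - \<omega> *\<^sub>R u'))\<^sup>2 \<le>
      (1 + 3 * \<omega> + 2 * \<omega>\<^sup>2) * (norm u)\<^sup>2 + (2 * \<omega>\<^sup>2 + \<omega>) * (norm u')\<^sup>2"
    by (simp add: algebra_simps power2_eq_square)
  have "\<alpha> * \<omega> * (2 * (a' \<bullet> a)) \<le> \<alpha> * \<omega> * ((norm a')\<^sup>2 + (norm a)\<^sup>2)"
    using assms by (intro mult_left_mono young) simp
  then have "- 2 * \<alpha> * ((1 + \<omega>) * (a \<bullet> a) - \<omega> * (a' \<bullet> a)) \<le>
      - (2 * \<alpha> + \<alpha> * \<omega>) * (norm a)\<^sup>2 + \<omega> * \<alpha> * (norm a')\<^sup>2"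
    by (simp add: algebra_simps power2_norm_eq_inner)
  moreover have "(2 * \<alpha> + \<alpha> * \<omega>) * (s * (norm u)\<^sup>2) \<le> (2 * \<alpha> + \<alpha> * \<omega>) * (norm a)\<^sup>2"
    using assms(1,2) by (intro mult_left_mono[OF a]) simp
  moreover have "\<omega> * \<alpha> * (norm a')\<^sup>2 \<le> \<omega> * \<alpha> * (S * (norm u')\<^sup>2)"
    using assms(1,2) by (intro mult_left_mono[OF a']) simp
  ultimately have 2: "- 2 * \<alpha> * ((1 + \<omega>) * (a \<bullet> a) - \<omega> * (a' \<bullet> a)) \<le>
      - (2 * \<alpha> + \<alpha> * \<omega>) * (s * (norm u)\<^sup>2) + \<omega> * \<alpha> * (S * (norm u')\<^sup>2)"
    by linarith
  have "(norm (u + r))\<^sup>2 \<le> 2 * (norm u)\<^sup>2 + 2 * (norm r)\<^sup>2"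
    using young(1)[of u r]
    by (simp add: power2_norm_eq_inner inner_add_left inner_add_right inner_commute)
  then have "\<beta> * (norm (u + r))\<^sup>2 \<le> \<beta> * (2 * (norm u)\<^sup>2 + 2 * (norm r)\<^sup>2)"
    using assms by (intro mult_left_mono)
  with m have "m \<le> \<beta> * (2 * (norm u)\<^sup>2 + 2 * (norm r)\<^sup>2)"
    by linarith
  then have "\<alpha>\<^sup>2 * m \<le> \<alpha>\<^sup>2 * (\<beta> * (2 * (norm u)\<^sup>2 + 2 * (norm r)\<^sup>2))"
    by (intro mult_left_mono) simp_all
  with 1 2 show ?thesis
    by (simp add: algebra_simps)
qed

lemma (in prob_space) nn_integral_momentum_step_le:
  fixes G :: "'a \<Rightarrow> real ^ 'm ^ 'm" and A :: "real ^ 'n ^ 'm"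
  assumes A: "A \<noteq> 0"
    and G: "integrable M G" and G2: "integrable M (\<lambda>q. transpose (G q) ** G q)"
    and mean: "(\<integral>q. G q \<partial>M) = (1 / (frobenius_norm A)\<^sup>2) *\<^sub>R (A ** transpose A)"
    and \<beta>: "\<beta> = spectral_norm (\<integral>q. transpose (G q) ** G q \<partial>M)"
    and "\<alpha> \<ge> 0" "\<omega> \<ge> 0"
    and \<gamma>1: "\<gamma>1 = 1 + 3 * \<omega> + 2 * \<omega>\<^sup>2
           - (2 * \<alpha> + \<alpha> * \<omega>) * ((sigma_min A)\<^sup>2 / (frobenius_norm A)\<^sup>2) + 2 * \<alpha>\<^sup>2 * \<beta>"
    and \<gamma>2: "\<gamma>2 = 2 * \<omega>\<^sup>2 + \<omega> + \<omega> * \<alpha> * ((sigma_max A)\<^sup>2 / (frobenius_norm A)\<^sup>2)"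
    and u: "u \<in> range ((*v) A)" and r: "transpose A *v r = 0"
  shows "(\<integral>\<^sup>+q. ennreal ((norm (u - \<alpha> *\<^sub>R (G q *v (u + r)) + \<omega> *\<^sub>R (u - u')))\<^sup>2) \<partial>M)
    \<le> ennreal (\<gamma>1 * (norm u)\<^sup>2 + \<gamma>2 * (norm u')\<^sup>2 + 2 * \<alpha>\<^sup>2 * \<beta> * (norm r)\<^sup>2)"
proof -
  define p where "p = (1 + \<omega>) *\<^sub>R u - \<omega> *\<^sub>R u'"
  define c where "c = 1 / frobenius_norm A"
  \<comment> \<open>Normalised so that \<open>T v \<bullet> T u\<close> is the bilinear form of the
    mean of \<open>G\<close>.\<close>
  define T where "T = (\<lambda>v. c *\<^sub>R (transpose A *v v))"
  have c2: "c\<^sup>2 = 1 / (frobenius_norm A)\<^sup>2"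
    by (simp add: c_def power_divide)
  have \<beta>0: "\<beta> \<ge> 0"
    unfolding \<beta> by (intro onorm_pos_le) simp
  have K: "v \<bullet> ((\<integral>q. G q \<partial>M) *v (u + r)) = T v \<bullet> T u" for v
  proof -
    have "(\<integral>q. G q \<partial>M) *v (u + r) = c\<^sup>2 *\<^sub>R (A *v (transpose A *v (u + r)))"
      unfolding mean c2 by (simp only: scaleR_matrix_vector_assoc matrix_vector_mul_assoc)
    \<comment> \<open>The least-squares residual drops out of the cross term here and survives only
      in the second-moment term.\<close>
    also have "transpose A *v (u + r) = transpose A *v u"
      unfolding matrix_vector_right_distrib r by simp
    finally show ?thesis
      by (simp add: T_def inner_commute[of v] matrix_vector_inner_transpose power2_eq_square
          inner_commute[of "transpose A *v u"] del: transpose_matrix_vector)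
  qed
  have pK: "p \<bullet> ((\<integral>q. G q \<partial>M) *v (u + r)) = (1 + \<omega>) * (T u \<bullet> T u) - \<omega> * (T u' \<bullet> T u)"
    unfolding K[symmetric] by (simp only: p_def inner_diff_left inner_scaleR_left)
  have nT: "(norm (T v))\<^sup>2 = (norm (transpose A *v v))\<^sup>2 / (frobenius_norm A)\<^sup>2" for v
    unfolding T_def norm_scaleR power_mult_distrib power2_abs c2 by simp
  obtain x where x: "u = A *v x"
    using u by blast
  have eq: "p - \<alpha> *\<^sub>R (G q *v (u + r)) = u - \<alpha> *\<^sub>R (G q *v (u + r)) + \<omega> *\<^sub>R (u - u')" for q
    by (simp add: p_def algebra_simps)
  have "(\<integral>\<^sup>+q. ennreal ((norm (u - \<alpha> *\<^sub>R (G q *v (u + r)) + \<omega> *\<^sub>R (u - u')))\<^sup>2) \<partial>M) =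
      (\<integral>\<^sup>+q. ennreal ((norm (p - \<alpha> *\<^sub>R (G q *v (u + r))))\<^sup>2) \<partial>M)"
    by (simp only: eq)
  also have "\<dots> = ennreal (\<integral>q. (norm (p - \<alpha> *\<^sub>R (G q *v (u + r))))\<^sup>2 \<partial>M)"
    by (intro nn_integral_eq_integral integrable_norm_affine G G2) simp
  also have "\<dots> \<le> ennreal (\<gamma>1 * (norm u)\<^sup>2 + \<gamma>2 * (norm u')\<^sup>2 + 2 * \<alpha>\<^sup>2 * \<beta> * (norm r)\<^sup>2)"
    unfolding integral_norm_affine[OF G G2] pK
    unfolding p_def \<gamma>1 \<gamma>2
  proof (intro ennreal_leI momentum_quadratic_bound assms(6,7) \<beta>0)
    show "(\<integral>q. (norm (G q *v (u + r)))\<^sup>2 \<partial>M) \<le> \<beta> * (norm (u + r))\<^sup>2"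
      unfolding \<beta> by (rule integral_norm_matrix_vector_le[OF G2])
    show "(sigma_min A)\<^sup>2 / (frobenius_norm A)\<^sup>2 * (norm u)\<^sup>2 \<le> (norm (T u))\<^sup>2"
      using divide_right_mono[OF sigma_min_le_norm_transpose[OF A, of x], of "(norm A)\<^sup>2"]
      unfolding nT x by simp
    show "(norm (T u'))\<^sup>2 \<le> (sigma_max A)\<^sup>2 / (frobenius_norm A)\<^sup>2 * (norm u')\<^sup>2"
      using divide_right_mono[OF norm_transpose_le_sigma_max[of A u'], of "(norm A)\<^sup>2"]
      unfolding nT by simp
  qed
  finally show ?thesis .
qed

text \<open>On a nonzero vector \<open>u\<close> in the range of \<open>A\<close>, the mean of
  \<open>G\<close> stretches by at least \<open>s\<close>, while Jensen bounds the squared norm of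
  the mean by the second moment. This provides \<open>\<beta> > 0\<close> and, with the step-size
  bound, the sign of \<open>\<gamma>1\<close>.\<close>

lemma (in prob_space) sigma_min_le_second_moment:
  fixes G :: "'a \<Rightarrow> real ^ 'm ^ 'm" and A :: "real ^ 'n ^ 'm"
  assumes A: "A \<noteq> 0"
    and G: "integrable M G" and G2: "integrable M (\<lambda>q. transpose (G q) ** G q)"
    and mean: "(\<integral>q. G q \<partial>M) = (1 / (frobenius_norm A)\<^sup>2) *\<^sub>R (A ** transpose A)"
  shows "((sigma_min A)\<^sup>2 / (frobenius_norm A)\<^sup>2)\<^sup>2 \<le> spectral_norm (\<integral>q. transpose (G q) ** G q \<partial>M)"
proof -
  define s where "s = (sigma_min A)\<^sup>2 / (frobenius_norm A)\<^sup>2"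
  let ?\<beta> = "spectral_norm (\<integral>q. transpose (G q) ** G q \<partial>M)"
  obtain x where "A *v x \<noteq> 0"
    using A by (metis matrix_eq matrix_vector_mult_0)
  define u where "u = A *v x"
  define p where "p = (\<integral>q. G q \<partial>M) *v u"
  have u: "norm u > 0"
    using \<open>A *v x \<noteq> 0\<close> by (simp add: u_def)
  \<comment> \<open>Jensen as nonnegativity of the variance: \<open>p\<close> is the mean of
    \<open>G q *v u\<close>.\<close>
  have "0 \<le> (\<integral>q. (norm (p - 1 *\<^sub>R (G q *v u)))\<^sup>2 \<partial>M)"
    by simp
  then have "(norm p)\<^sup>2 \<le> (\<integral>q. (norm (G q *v u))\<^sup>2 \<partial>M)"
    unfolding integral_norm_affine[OF G G2] p_def[symmetric] by (simp add: power2_norm_eq_inner)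
  also have "\<dots> \<le> ?\<beta> * (norm u)\<^sup>2"
    by (rule integral_norm_matrix_vector_le[OF G2])
  finally have p: "(norm p)\<^sup>2 \<le> ?\<beta> * (norm u)\<^sup>2" .
  have "s * (norm u)\<^sup>2 \<le> (norm (transpose A *v u))\<^sup>2 / (frobenius_norm A)\<^sup>2"
    using divide_right_mono[OF sigma_min_le_norm_transpose[OF A, of x], of "(norm A)\<^sup>2"]
    by (simp add: s_def u_def)
  also have "\<dots> = u \<bullet> p"
  proof -
    have p: "p = (1 / (frobenius_norm A)\<^sup>2) *\<^sub>R (A *v (transpose A *v u))"
      unfolding p_def mean by (simp only: scaleR_matrix_vector_assoc matrix_vector_mul_assoc)
    have "u \<bullet> (A *v (transpose A *v u)) = (norm (transpose A *v u))\<^sup>2"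
      unfolding power2_norm_eq_inner by (rule trans[OF inner_commute matrix_vector_inner_transpose])
    then show ?thesis
      unfolding p inner_scaleR_right by (simp only: mult_1 times_divide_eq_left)
  qed
  also have "\<dots> \<le> norm u * norm p"
    by (rule norm_cauchy_schwarz)
  finally have "s * norm u \<le> norm p"
    using u by (simp add: power2_eq_square)
  then have "(s * norm u)\<^sup>2 \<le> (norm p)\<^sup>2"
    by (intro power_mono) (simp_all add: s_def)
  with p have "s\<^sup>2 * (norm u)\<^sup>2 \<le> ?\<beta> * (norm u)\<^sup>2"
    by (simp add: power_mult_distrib)
  then show ?thesis
    using u by (simp add: s_def)
qed

text \<open>From \<open>\<alpha> * s\<^sup>2 \<le> \<alpha> * \<beta> \<le> s\<close> follows
  \<open>\<alpha> * s \<le> 1\<close>. With x = \<open>\<alpha> * s\<close> the expression is then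
  at least (1 - x)^2 + x^2 + omega (3 - x) + 2 omega^2.\<close>

lemma momentum_coefficient_nonneg:
  fixes \<alpha> \<beta> \<omega> s :: real
  assumes "0 < \<alpha>" "\<alpha> * \<beta> \<le> s" "s\<^sup>2 \<le> \<beta>" "s > 0" "\<omega> \<ge> 0"
  shows "1 + 3 * \<omega> + 2 * \<omega>\<^sup>2 - (2 * \<alpha> + \<alpha> * \<omega>) * s + 2 * \<alpha>\<^sup>2 * \<beta> \<ge> 0"
proof -
  have "\<alpha> * s\<^sup>2 \<le> \<alpha> * \<beta>" "2 * \<alpha>\<^sup>2 * s\<^sup>2 \<le> 2 * \<alpha>\<^sup>2 * \<beta>"
    using assms by (intro mult_left_mono; simp)+
  moreover have "(\<alpha> * s) * s \<le> 1 * s"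
    using order_trans[OF calculation(1) assms(2)] by (simp add: power2_eq_square mult.assoc)
  then have "\<alpha> * s \<le> 1"
    by (rule mult_right_le_imp_le) fact
  then have "0 \<le> \<omega> * (3 - \<alpha> * s)"
    using assms by (intro mult_nonneg_nonneg) simp_all
  moreover have "0 \<le> (1 - \<alpha> * s)\<^sup>2 + (\<alpha> * s)\<^sup>2 + 2 * \<omega>\<^sup>2"
    by simp
  ultimately show ?thesis
    by (simp add: power2_eq_square algebra_simps)
qed

section \<open>From one averaged step to the whole iteration\<close>

lemma (in prob_space)
  fixes G :: "'q \<Rightarrow> real ^ 'm ^ 'm" and Q :: "nat \<Rightarrow> 'a \<Rightarrow> 'q" and e :: "nat \<Rightarrow> 'a \<Rightarrow> real ^ 'm"
  assumes ind: "indep_vars (\<lambda>_. N) Q {1..}" and dist: "\<And>k. k \<ge> 1 \<Longrightarrow> distr M N (Q k) = D"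
    and G[measurable]: "G \<in> borel_measurable N"
    and start: "\<And>w. w \<in> space M \<Longrightarrow> e 0 w = e0" "\<And>w. w \<in> space M \<Longrightarrow> e 1 w = e0"
    and rec: "\<And>k w. w \<in> space M \<Longrightarrow> e (Suc (Suc k)) w =
      e (Suc k) w - \<alpha> *\<^sub>R (G (Q (Suc k) w) *v (e (Suc k) w + r)) + \<omega> *\<^sub>R (e (Suc k) w - e k w)"
    and V: "\<And>k w. w \<in> space M \<Longrightarrow> e k w \<in> V"
    and step: "\<And>u u'. u \<in> V \<Longrightarrow>
      (\<integral>\<^sup>+q. ennreal ((norm (u - \<alpha> *\<^sub>R (G q *v (u + r)) + \<omega> *\<^sub>R (u - u')))\<^sup>2) \<partial>D)
        \<le> ennreal (\<gamma>1 * (norm u)\<^sup>2 + \<gamma>2 * (norm u')\<^sup>2 + c)"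
    and nonneg: "\<gamma>1 \<ge> 0" "\<gamma>2 \<ge> 0" "c \<ge> 0"
  shows momentum_iteration_integrable: "integrable M (\<lambda>w. (norm (e k w))\<^sup>2)"
    and momentum_iteration_integral_le: "(\<integral>w. (norm (e (Suc (Suc k)) w))\<^sup>2 \<partial>M) \<le>
      \<gamma>1 * (\<integral>w. (norm (e (Suc k) w))\<^sup>2 \<partial>M) + \<gamma>2 * (\<integral>w. (norm (e k w))\<^sup>2 \<partial>M) + c"
proof -
  let ?P = "borel \<Otimes>\<^sub>M borel :: ((real ^ 'm) \<times> (real ^ 'm)) measure"
  \<comment> \<open>Pairing consecutive errors makes the recursion first order;
    \<open>Q (Suc k)\<close> leads from \<open>Z k\<close> to \<open>Z (Suc k)\<close>.\<close>
  define Z where "Z = (\<lambda>k w. (e (Suc k) w, e k w))"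
  define F where "F = (\<lambda>z q. (fst z - \<alpha> *\<^sub>R (G q *v (fst z + r)) + \<omega> *\<^sub>R (fst z - snd z), fst z))"
  note [measurable] = borel_measurable_matrix_vector_mult
  have F: "(\<lambda>(z, q). F z q) \<in> ?P \<Otimes>\<^sub>M N \<rightarrow>\<^sub>M ?P"
    unfolding F_def by measurable
  have Z: "(e0, e0) \<in> space ?P" "\<And>w. w \<in> space M \<Longrightarrow> Z 0 w = (e0, e0)"
    "\<And>k w. w \<in> space M \<Longrightarrow> Z (Suc k) w = F (Z k w) (Q (Suc k) w)"
    using start rec by (simp_all add: Z_def F_def space_pair_measure)
  have Zm[measurable]: "Z k \<in> M \<rightarrow>\<^sub>M ?P" for k
    by (rule markov_chain_measurable[OF ind F Z])
  have em[measurable]: "e k \<in> borel_measurable M" for k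
    using measurable_compose[OF Zm measurable_snd] by (simp add: Z_def)
  define E where "E = (\<lambda>k. \<integral>w. (norm (e k w))\<^sup>2 \<partial>M)"
  have next_le: "(\<integral>\<^sup>+w. ennreal ((norm (e (Suc (Suc k)) w))\<^sup>2) \<partial>M) \<le>
      ennreal (\<gamma>1 * E (Suc k) + \<gamma>2 * E k + c)"
    if int: "integrable M (\<lambda>w. (norm (e k w))\<^sup>2)" "integrable M (\<lambda>w. (norm (e (Suc k) w))\<^sup>2)" for k
  proof -
    have "(\<integral>\<^sup>+w. ennreal ((norm (e (Suc (Suc k)) w))\<^sup>2) \<partial>M) =
        (\<integral>\<^sup>+w. (\<lambda>z. ennreal ((norm (fst z))\<^sup>2)) (Z (Suc k) w) \<partial>M)"
      by (simp add: Z_def)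
    also have "\<dots> = (\<integral>\<^sup>+w. (\<integral>\<^sup>+q. (\<lambda>z. ennreal ((norm (fst z))\<^sup>2)) (F (Z k w) q) \<partial>D) \<partial>M)"
      by (rule markov_chain_nn_integral[OF ind dist F Z]) simp_all
    also have "\<dots> \<le> (\<integral>\<^sup>+w. ennreal (\<gamma>1 * (norm (e (Suc k) w))\<^sup>2 + \<gamma>2 * (norm (e k w))\<^sup>2 + c) \<partial>M)"
      using step V by (intro nn_integral_mono) (simp add: F_def Z_def)
    also have "\<dots> = ennreal (\<integral>w. \<gamma>1 * (norm (e (Suc k) w))\<^sup>2 + \<gamma>2 * (norm (e k w))\<^sup>2 + c \<partial>M)"
      using int nonneg by (intro nn_integral_eq_integral) simp_all
    also have "\<dots> = ennreal (\<gamma>1 * E (Suc k) + \<gamma>2 * E k + c)"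
      using int by (simp add: E_def prob_space)
    finally show ?thesis .
  qed
  \<comment> \<open>Induction over two consecutive times, since \<open>next_le\<close> needs both;
    its real right-hand side makes the next second moment finite.\<close>
  have "integrable M (\<lambda>w. (norm (e k w))\<^sup>2) \<and> integrable M (\<lambda>w. (norm (e (Suc k) w))\<^sup>2)" for k
  proof (induction k)
    case 0
    have "integrable M (\<lambda>w. (norm (e i w))\<^sup>2)" if "i \<le> 1" for i
      using Bochner_Integration.integrable_cong[of M M "\<lambda>w. (norm (e i w))\<^sup>2" "\<lambda>_. (norm e0)\<^sup>2"] start that
      by (auto simp: le_Suc_eq)
    then show ?case
      by simp
  next
    case (Suc k)
    then show ?case
      using next_le[of k] by (auto intro!: integrableI_nonneg simp: le_less_trans)
  qed
  then show int: "integrable M (\<lambda>w. (norm (e k w))\<^sup>2)" for k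
    by blast
  have "0 \<le> \<gamma>1 * E (Suc k) + \<gamma>2 * E k + c"
    using nonneg by (simp add: E_def)
  moreover have "ennreal (E (Suc (Suc k))) \<le> ennreal (\<gamma>1 * E (Suc k) + \<gamma>2 * E k + c)"
    using next_le[OF int int, of k] nn_integral_eq_integral[OF int, of "Suc (Suc k)"] by (simp add: E_def)
  ultimately show "(\<integral>w. (norm (e (Suc (Suc k)) w))\<^sup>2 \<partial>M) \<le>
      \<gamma>1 * (\<integral>w. (norm (e (Suc k) w))\<^sup>2 \<partial>M) + \<gamma>2 * (\<integral>w. (norm (e k w))\<^sup>2 \<partial>M) + c"
    unfolding E_def by (simp only: ennreal_le_iff)
qed

text \<open>The sum in \<open>mult_transpose\<close> runs over the length of its first argument, so
  swapping the arguments relies on equal lengths.\<close>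

lemma transpose_mult_transpose:
  assumes "length U = length V"
  shows "transpose (mult_transpose U V) = mult_transpose V U"
  using assms by (simp add: mult_transpose_def transpose_def vec_eq_iff mult.commute)

lemma length_space_quadruple_algebra:
  assumes "(S1, S2, T1, T2) \<in> space quadruple_algebra"
  shows "length S1 = length S2" "length T1 = length T2"
  using assms by (auto simp: quadruple_algebra_def space_restrict_space)

theorem theorem4p1:
  fixes A :: "real ^ 'n ^ 'm" and b :: "real ^ 'm"
    and D :: "('m, 'n) quadruple measure"
    and M :: "'w measure"
    and S1 S2 :: "nat \<Rightarrow> 'w \<Rightarrow> 'm columns"
    and T1 T2 :: "nat \<Rightarrow> 'w \<Rightarrow> 'n columns"
    and x :: "nat \<Rightarrow> 'w \<Rightarrow> real ^ 'n" and x0 x_LS :: "real ^ 'n"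
    and r :: "nat \<Rightarrow> 'w \<Rightarrow> real ^ 'm" and r_star :: "real ^ 'm"
    and \<alpha> \<omega> \<beta> \<gamma>1 \<gamma>2 q \<tau> :: real
  assumes "A \<noteq> 0"
    and "prob_space D" and "sets D = sets quadruple_algebra"
    and "integrable D (\<lambda>(S1, S2, T1, T2).
           mult_transpose T1 T2 ** transpose A ** mult_transpose S1 S2)"
    and "integral\<^sup>L D (\<lambda>(S1, S2, T1, T2).
           mult_transpose T1 T2 ** transpose A ** mult_transpose S1 S2)
         = (1 / (frobenius_norm A)\<^sup>2) *\<^sub>R transpose A"
    and "integrable D (\<lambda>(S1, S2, T1, T2).
           mult_transpose S2 S1 ** A ** mult_transpose T2 T1 ** transpose A ** A
             ** mult_transpose T1 T2 ** transpose A ** mult_transpose S1 S2)"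
    and "\<beta> = spectral_norm (integral\<^sup>L D (\<lambda>(S1, S2, T1, T2).
           mult_transpose S2 S1 ** A ** mult_transpose T2 T1 ** transpose A ** A
             ** mult_transpose T1 T2 ** transpose A ** mult_transpose S1 S2))"
    and "prob_space M"
    and "prob_space.indep_vars M (\<lambda>_. quadruple_algebra)
           (\<lambda>k w. (S1 k w, S2 k w, T1 k w, T2 k w)) {1..}"
    and "\<forall>k\<ge>1. distr M quadruple_algebra (\<lambda>w. (S1 k w, S2 k w, T1 k w, T2 k w)) = D"
    and "\<forall>w\<in>space M. x 0 w = x0 \<and> x 1 w = x0"
    and "\<forall>w\<in>space M. \<forall>k\<ge>1. x (k + 1) w =
           x k w
           - \<alpha> *\<^sub>R ((mult_transpose (T1 k w) (T2 k w) ** transpose A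
                    ** mult_transpose (S1 k w) (S2 k w)) *v (A *v x k w - b))
           + \<omega> *\<^sub>R (x k w - x (k - 1) w)"
    and "x_LS = pseudoinverse A *v b"
    and "r_star = A *v x_LS - b"
    and "\<forall>k. \<forall>w\<in>space M. r k w = A *v x k w - b"
    and "0 < \<alpha>" and "\<alpha> < (sigma_min A)\<^sup>2 / (\<beta> * (frobenius_norm A)\<^sup>2)"
    and "\<omega> \<ge> 0"
    and "\<gamma>1 = 1 + 3 * \<omega> + 2 * \<omega>\<^sup>2
           - (2 * \<alpha> + \<alpha> * \<omega>) * ((sigma_min A)\<^sup>2 / (frobenius_norm A)\<^sup>2) + 2 * \<alpha>\<^sup>2 * \<beta>"
    and "\<gamma>2 = 2 * \<omega>\<^sup>2 + \<omega> + \<omega> * \<alpha> * ((sigma_max A)\<^sup>2 / (frobenius_norm A)\<^sup>2)"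
    and "\<gamma>1 + \<gamma>2 < 1"
    and "q = (if \<omega> > 0 then (\<gamma>1 + sqrt (\<gamma>1\<^sup>2 + 4 * \<gamma>2)) / 2 else \<gamma>1)"
    and "\<tau> = q - \<gamma>1"
  shows "(\<forall>k. integrable M (\<lambda>w. (norm (r (k + 1) w - r_star))\<^sup>2) \<and>
           integral\<^sup>L M (\<lambda>w. (norm (r (k + 1) w - r_star))\<^sup>2)
             \<le> q ^ k * (1 + \<tau>) * (norm (A *v x0 - b - r_star))\<^sup>2
               + 2 * \<alpha>\<^sup>2 * \<beta> * (1 - q ^ k) * (norm r_star)\<^sup>2 / (1 - q))
         \<and> \<tau> \<ge> 0 \<and> \<gamma>1 + \<gamma>2 \<le> q \<and> q < 1"
proof -
  interpret M: prob_space M by fact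
  interpret D: prob_space D by fact
  define Q where "Q = (\<lambda>k w. (S1 k w, S2 k w, T1 k w, T2 k w))"
  define H :: "('m, 'n) quadruple \<Rightarrow> real ^ 'm ^ 'n" where
    "H = (\<lambda>(S1, S2, T1, T2). mult_transpose T1 T2 ** transpose A ** mult_transpose S1 S2)"
  \<comment> \<open>The update as it acts on residuals; its Gram matrix is the matrix behind
    \<open>\<beta>\<close>.\<close>
  define G where "G = (\<lambda>q. A ** H q)"
  define B :: "('m, 'n) quadruple \<Rightarrow> real ^ 'm ^ 'm" where
    "B = (\<lambda>(S1, S2, T1, T2). mult_transpose S2 S1 ** A ** mult_transpose T2 T1 ** transpose A ** A
             ** mult_transpose T1 T2 ** transpose A ** mult_transpose S1 S2)"
  define s where "s = (sigma_min A)\<^sup>2 / (frobenius_norm A)\<^sup>2"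
  define e where "e = (\<lambda>k w. r k w - r_star)"
  define e0 where "e0 = A *v x0 - b - r_star"
  have H: "integrable D H" "integral\<^sup>L D H = (1 / (frobenius_norm A)\<^sup>2) *\<^sub>R transpose A"
    and B: "integrable D B" "\<beta> = spectral_norm (integral\<^sup>L D B)"
    unfolding H_def B_def by fact+
  have space_D: "space D = space quadruple_algebra"
    by (rule sets_eq_imp_space_eq) fact
  \<comment> \<open>Points of the space of \<open>D\<close> have paired lists of equal length, so
    this identity is available throughout the integrals.\<close>
  have BG: "B q = transpose (G q) ** G q" if "q \<in> space D" for q
  proof -
    obtain S1 S2 T1 T2 where q: "q = (S1, S2, T1, T2)"
      by (metis prod.exhaust)
    then have "length S1 = length S2" "length T1 = length T2"
      using that length_space_quadruple_algebra unfolding space_D by blast+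
    then show ?thesis
      by (simp add: q B_def G_def H_def matrix_transpose_mul transpose_mult_transpose matrix_mul_assoc)
  qed
  have bl: "bounded_linear (\<lambda>X :: real ^ 'm ^ 'n. A ** X)"
    by (rule bounded_linear_matrix_mult_right)
  have G: "integrable D G"
    unfolding G_def by (rule integrable_bounded_linear[OF bl H(1)])
  have mean: "integral\<^sup>L D G = (1 / (frobenius_norm A)\<^sup>2) *\<^sub>R (A ** transpose A)"
    unfolding G_def integral_bounded_linear[OF bl H(1)] H(2)
    using linear_scale[OF bounded_linear.linear[OF bl]] by simp
  have G2: "integrable D (\<lambda>q. transpose (G q) ** G q)"
    using B(1) BG by (simp cong: Bochner_Integration.integrable_cong)
  have \<beta>: "\<beta> = spectral_norm (\<integral>q. transpose (G q) ** G q \<partial>D)"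
    unfolding B(2) using BG by (simp cong: Bochner_Integration.integral_cong)
  have Gm: "G \<in> borel_measurable quadruple_algebra"
    using borel_measurable_integrable[OF G] measurable_cong_sets[OF assms(3) refl] by blast
  have \<beta>_ge: "s\<^sup>2 \<le> \<beta>"
    unfolding s_def \<beta> by (rule D.sigma_min_le_second_moment[OF assms(1) G G2 mean])
  have s: "s > 0"
    using sigma_min_pos[OF assms(1)] assms(1) by (simp add: s_def)
  then have "\<beta> > 0"
    using \<beta>_ge zero_less_power[of s 2] by linarith
  moreover have "\<alpha> < s / \<beta>"
    using assms(17) by (simp add: s_def mult.commute)
  ultimately have "\<alpha> * \<beta> \<le> s"
    by (simp add: less_divide_eq)
  then have \<gamma>1: "\<gamma>1 \<ge> 0"
    unfolding assms(19) s_def[symmetric]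
    using assms(16,18) \<beta>_ge s by (intro momentum_coefficient_nonneg)
  have \<gamma>2: "\<gamma>2 \<ge> 0"
    unfolding assms(20) using assms(16,18) by simp
  have c: "2 * \<alpha>\<^sup>2 * \<beta> * (norm r_star)\<^sup>2 \<ge> 0"
    using \<open>\<beta> > 0\<close> by simp
  have r_star: "transpose A *v r_star = 0"
    unfolding assms(14,13) by (rule transpose_least_squares_residual)
  have e_eq: "e k w = A *v (x k w - x_LS)" if "w \<in> space M" for k w
    using assms(14,15) that by (simp add: e_def matrix_vector_mult_diff_distrib)
  have rec: "e (Suc (Suc k)) w =
      e (Suc k) w - \<alpha> *\<^sub>R (G (Q (Suc k) w) *v (e (Suc k) w + r_star)) + \<omega> *\<^sub>R (e (Suc k) w - e k w)"
    if w: "w \<in> space M" for k w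
  proof -
    have "x (Suc (Suc k)) w = x (Suc k) w - \<alpha> *\<^sub>R (H (Q (Suc k) w) *v r (Suc k) w)
        + \<omega> *\<^sub>R (x (Suc k) w - x k w)"
      using assms(12)[rule_format, OF w, of "Suc k"] assms(15) w by (simp add: H_def Q_def)
    moreover have "e (Suc k) w + r_star = r (Suc k) w"
      by (simp add: e_def)
    ultimately show ?thesis
      by (simp add: e_eq[OF w] G_def matrix_vector_mult_diff_distrib matrix_vector_right_distrib
          matrix_vector_mult_scaleR flip: matrix_vector_mul_assoc)
  qed
  have range: "e k w \<in> range ((*v) A)" if "w \<in> space M" for k w
    using e_eq[OF that] by simp
  have start: "e 0 w = e0" "e 1 w = e0" if "w \<in> space M" for w
    using assms(11,15) that by (simp_all add: e_def e0_def)
  have ind: "M.indep_vars (\<lambda>_. quadruple_algebra) Q {1..}"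
    unfolding Q_def by fact
  have dist: "distr M quadruple_algebra (Q k) = D" if "k \<ge> 1" for k
    using assms(10) that by (simp add: Q_def)
  have step: "(\<integral>\<^sup>+q. ennreal ((norm (u - \<alpha> *\<^sub>R (G q *v (u + r_star)) + \<omega> *\<^sub>R (u - u')))\<^sup>2) \<partial>D)
      \<le> ennreal (\<gamma>1 * (norm u)\<^sup>2 + \<gamma>2 * (norm u')\<^sup>2 + 2 * \<alpha>\<^sup>2 * \<beta> * (norm r_star)\<^sup>2)"
    if "u \<in> range ((*v) A)" for u u'
    using assms(16,18) that
    by (intro D.nn_integral_momentum_step_le[OF assms(1) G G2 mean \<beta> _ _ assms(19,20) _ r_star]) simp_all
  define E where "E = (\<lambda>k. \<integral>w. (norm (e k w))\<^sup>2 \<partial>M)"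
  have int: "integrable M (\<lambda>w. (norm (e k w))\<^sup>2)" for k
    by (rule M.momentum_iteration_integrable[OF ind dist Gm start rec range step \<gamma>1 \<gamma>2 c])
  have le: "E (Suc (Suc k)) \<le> \<gamma>1 * E (Suc k) + \<gamma>2 * E k + 2 * \<alpha>\<^sup>2 * \<beta> * (norm r_star)\<^sup>2" for k
    unfolding E_def
    by (rule M.momentum_iteration_integral_le[OF ind dist Gm start rec range step \<gamma>1 \<gamma>2 c])
  have E01: "E k = (\<integral>w. (norm e0)\<^sup>2 \<partial>M)" if "k = 0 \<or> k = 1" for k
    unfolding E_def using start that by (intro Bochner_Integration.integral_cong) auto
  from this[of 0] have E0: "E 0 = (norm e0)\<^sup>2"
    by (simp add: M.prob_space)
  \<comment> \<open>For \<open>\<omega> = 0\<close> also \<open>\<gamma>2 = 0\<close>, and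
    \<open>\<gamma>1 \<ge> 0\<close> reduces the root formula to \<open>\<gamma>1\<close>.\<close>
  have q: "q = (\<gamma>1 + sqrt (\<gamma>1\<^sup>2 + 4 * \<gamma>2)) / 2"
    using assms(18,20,22) \<gamma>1 by auto
  have E_nonneg: "E k \<ge> 0" for k
    by (simp add: E_def)
  have E1: "E 1 = E 0"
    using E01[of 0] E01[of 1] by simp
  note bound = two_step_recursion_bound[of E, OF E_nonneg E1 \<gamma>1 \<gamma>2 assms(21) le q]
  have "E (k + 1) \<le> q ^ k * (1 + \<tau>) * (norm (A *v x0 - b - r_star))\<^sup>2
      + 2 * \<alpha>\<^sup>2 * \<beta> * (1 - q ^ k) * (norm r_star)\<^sup>2 / (1 - q)" for k
    using bound(4)[of k] by (simp add: E0 e0_def assms(23) mult_ac)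
  then show ?thesis
    using bound(1-3) int unfolding E_def e_def by (simp add: assms(23))
qed

end
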